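(* For every integer $r \geq 4$ and for every $2$-regular $0,1$ matrix $M$ with $\mathrm{rank}_{\mathrm{bin}}(M) = r$, the binary rank of its complement satisfies \[\mathrm{rank}_{\mathrm{bin}}(\overline{M}) \geq \Big \lceil\frac{3r}{4} \Big \rceil+1.\]
   Context: A square $0,1$ matrix is $2$-regular if every row and every column has precisely two ones. $\overline{M}$ is the complement of $M$ (zeros and ones swapped). The binary rank $\mathrm{rank}_{\mathrm{bin}}(A)$ of a $0,1$ matrix $A$ is the smallest number of combinatorial rectangles (all-one submatrices indexed by a set of rows times a set of columns) that partition the ones of $A$ (equivalently, the smallest inner dimension of a factorization $A=A_1A_2$ over the reals with $0,1$ factors). *)

theory Defs
  imports "Jordan_Normal_Form.Matrix" "HOL-Library.Disjoint_Sets"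
begin

definition zero_one_mat :: "real mat \<Rightarrow> bool" where
  "zero_one_mat A \<longleftrightarrow> elements_mat A \<subseteq> {0, 1}"

definition two_regular_mat :: "real mat \<Rightarrow> bool" where
  "two_regular_mat A \<longleftrightarrow> square_mat A \<and> zero_one_mat A \<and>
     (\<forall>i < dim_row A. card {j. j < dim_col A \<and> A $$ (i, j) = 1} = 2) \<and>
     (\<forall>j < dim_col A. card {i. i < dim_row A \<and> A $$ (i, j) = 1} = 2)"

definition complement_mat :: "real mat \<Rightarrow> real mat" where
  "complement_mat A = mat (dim_row A) (dim_col A) (\<lambda>ij. 1 - A $$ ij)"

definition mat_ones :: "real mat \<Rightarrow> (nat \<times> nat) set" where
  "mat_ones A = {(i, j). i < dim_row A \<and> j < dim_col A \<and> A $$ (i, j) = 1}"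

definition all_one_rectangle :: "real mat \<Rightarrow> (nat \<times> nat) set \<Rightarrow> bool" where
  "all_one_rectangle A R \<longleftrightarrow> (\<exists>I J. R = I \<times> J \<and> R \<subseteq> mat_ones A)"

definition rectangle_partition :: "real mat \<Rightarrow> (nat \<times> nat) set set \<Rightarrow> bool" where
  "rectangle_partition A P \<longleftrightarrow>
     partition_on (mat_ones A) P \<and> (\<forall>R \<in> P. all_one_rectangle A R)"

definition binary_rank :: "real mat \<Rightarrow> nat" where
  "binary_rank A = (LEAST k. \<exists>P. rectangle_partition A P \<and> finite P \<and> card P = k)"

text \<open>The minimum in the definition of the binary rank is always attained.\<close>

lemma finite_mat_ones: "finite (mat_ones A)"
  by (rule finite_subset[of _ "{..<dim_row A} \<times> {..<dim_col A}"]) (auto simp: mat_ones_def)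

lemma rectangle_partition_singletons:
  "rectangle_partition A ((\<lambda>x. {x}) ` mat_ones A)"
  unfolding rectangle_partition_def partition_on_def all_one_rectangle_def
proof (intro conjI ballI)
  fix R assume "R \<in> (\<lambda>x. {x}) ` mat_ones A"
  then obtain i j where "(i, j) \<in> mat_ones A" "R = {i} \<times> {j}"
    by auto
  then show "\<exists>I J. R = I \<times> J \<and> R \<subseteq> mat_ones A"
    by blast
qed (auto simp: disjoint_def)

lemma binary_rank_attained:
  "\<exists>P. rectangle_partition A P \<and> finite P \<and> card P = binary_rank A"
  unfolding binary_rank_def
  by (rule LeastI_ex) (use rectangle_partition_singletons finite_mat_ones in blast)

end

theory Submission
  imports Defs
begin

text \<open>
  Call two rows adjacent if they share a one. The row components of a 2-regular matrix are cycles,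
  and the left kernel has one dimension for each bipartite (even) component. By regularity the
  complement has the same left kernel, so it needs at least \<open>n - e - b\<close> rectangles, where \<open>b\<close>
  counts the bipartite components of size two and \<open>e\<close> the larger ones. Since the two rows of
  a component of size two coincide, the binary rank of the matrix is at most \<open>n - b\<close>, and this is
  at least \<open>4 * e\<close>.

  The bound can thus only fail if the rank bound is attained. Then every vector in the left (right)
  kernel is orthogonal to the row (column) set of every rectangle, whence a rectangle meets the block
  of a bipartite component of size \<open>k\<close> in evenly many rows and columns and, unless the intersection
  is empty, in fewer than \<open>k\<close> rows and columns altogether. This excludes \<open>k = 4\<close>, and counting leaves a single component with \<open>k = 6\<close>
  and at most one component of size two, which is excluded by counting areas and incidences.
\<close>

section \<open>Homogeneous linear systems and sign vectors\<close>

text \<open>Gaussian elimination, one equation at a time: a coefficient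
  \<open>a k t \<noteq> 0\<close> lets the unknown \<open>k\<close> be eliminated from the other
  equations. The solution is also made zero outside \<open>S\<close>, so that it can be read as a
  vector on all indices with support in \<open>S\<close>.\<close>

lemma homogeneous_system_nontrivial:
  fixes a :: "'i \<Rightarrow> 't \<Rightarrow> 'f::field"
  assumes "finite T" "finite S" "card T < card S"
  shows "\<exists>x. (\<exists>i\<in>S. x i \<noteq> 0) \<and> (\<forall>i. i \<notin> S \<longrightarrow> x i = 0) \<and> (\<forall>t\<in>T. (\<Sum>i\<in>S. x i * a i t) = 0)"
  using assms
proof (induction T arbitrary: S a rule: finite_induct)
  case empty
  then have "S \<noteq> {}" by auto
  then show ?case
    by (intro exI[of _ "\<lambda>i. if i \<in> S then 1 else 0"]) auto
next
  case (insert t T)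
  show ?case
  proof (cases "\<forall>i\<in>S. a i t = 0")
    case True
    from insert have "card T < card S" by simp
    moreover have "(\<Sum>i\<in>S. x i * a i t) = 0" for x using True by simp
    ultimately show ?thesis using insert.IH[OF insert.prems(1), of a] by simp
  next
    case False
    then obtain k where k: "k \<in> S" "a k t \<noteq> 0" by blast
    define S' where "S' = S - {k}"
    have fin: "finite S'" and S: "S = insert k S'" "k \<notin> S'"
      using k insert.prems(1) by (auto simp: S'_def)
    have "card T < card S'" using insert.prems insert.hyps S fin by simp
    from insert.IH[OF fin this, of "\<lambda>i s. a i s - a k s * a i t / a k t"] obtain x where
      x: "\<exists>i\<in>S'. x i \<noteq> 0" "\<forall>i. i \<notin> S' \<longrightarrow> x i = 0"
      "\<forall>s\<in>T. (\<Sum>i\<in>S'. x i * (a i s - a k s * a i t / a k t)) = 0" by blast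
    \<comment> \<open>\<open>c\<close> is the value that equation \<open>t\<close> forces on the
      eliminated unknown \<open>k\<close>.\<close>
    define c where "c = - (\<Sum>i\<in>S'. x i * a i t) / a k t"
    define y where "y = x(k := c)"
    have sum: "(\<Sum>i\<in>S. y i * a i s) = c * a k s + (\<Sum>i\<in>S'. x i * a i s)" for s
    proof -
      have "(\<Sum>i\<in>S'. y i * a i s) = (\<Sum>i\<in>S'. x i * a i s)"
        by (rule sum.cong) (use S in \<open>auto simp: y_def\<close>)
      then show ?thesis using S fin by (simp add: y_def)
    qed
    have "(\<Sum>i\<in>S. y i * a i s) = 0" if s: "s \<in> T" for s
    proof -
      have "0 = (\<Sum>i\<in>S'. x i * a i s - a k s / a k t * (x i * a i t))"
        using x(3) s by (simp add: algebra_simps)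
      also have "\<dots> = (\<Sum>i\<in>S'. x i * a i s) - a k s / a k t * (\<Sum>i\<in>S'. x i * a i t)"
        by (simp add: sum_subtractf sum_distrib_left)
      finally show ?thesis unfolding sum c_def by (simp add: algebra_simps)
    qed
    moreover have "(\<Sum>i\<in>S. y i * a i t) = 0"
      unfolding sum c_def using k by simp
    moreover have "\<exists>i\<in>S. y i \<noteq> 0" using x(1) S by (auto simp: y_def)
    moreover have "\<forall>i. i \<notin> S \<longrightarrow> y i = 0" using x(2) S by (auto simp: y_def)
    ultimately show ?thesis by blast
  qed
qed

text \<open>The dependency \<open>u\<close> makes equation \<open>s\<close> a combination of the
  others, and dropping it leaves fewer equations than unknowns.\<close>

lemma dependent_homogeneous_system_nontrivial:
  fixes a :: "'i \<Rightarrow> 't \<Rightarrow> 'f::field"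
  assumes T: "finite T" and S: "finite S" and le: "card T \<le> card S"
    and s: "s \<in> T" "u s \<noteq> 0" and dep: "\<And>i. i \<in> S \<Longrightarrow> (\<Sum>t\<in>T. u t * a i t) = 0"
  shows "\<exists>x. (\<exists>i\<in>S. x i \<noteq> 0) \<and> (\<forall>i. i \<notin> S \<longrightarrow> x i = 0) \<and> (\<forall>t\<in>T. (\<Sum>i\<in>S. x i * a i t) = 0)"
proof -
  have "card (T - {s}) < card S" using T s le card_Diff1_less[OF T s(1)] by linarith
  from homogeneous_system_nontrivial[OF _ S this, of a] T obtain x where
    x: "\<exists>i\<in>S. x i \<noteq> 0" "\<forall>i. i \<notin> S \<longrightarrow> x i = 0"
    "\<forall>t\<in>T - {s}. (\<Sum>i\<in>S. x i * a i t) = 0" by blast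
  have "0 = (\<Sum>i\<in>S. x i * (\<Sum>t\<in>T. u t * a i t))" using dep by simp
  also have "\<dots> = (\<Sum>t\<in>T. u t * (\<Sum>i\<in>S. x i * a i t))"
    unfolding sum_distrib_left by (subst sum.swap) (simp add: algebra_simps)
  also have "\<dots> = u s * (\<Sum>i\<in>S. x i * a i s)"
    using T s x(3) by (subst sum.remove[of _ s]) auto
  finally have "(\<Sum>i\<in>S. x i * a i s) = 0" using s by simp
  with x show ?thesis by (intro exI[of _ x]) auto
qed

text \<open>Adding 1 to every sign gives values 0 and 2, whose total is the number of signs.\<close>

lemma even_card_if_signs_cancel:
  fixes w :: "'i \<Rightarrow> real"
  assumes "finite X" and "\<And>i. i \<in> X \<Longrightarrow> \<bar>w i\<bar> = 1" and "(\<Sum>i\<in>X. w i) = 0"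
  shows "even (card X)"
proof -
  have "real (card X) = (\<Sum>i\<in>X. w i + 1)" using assms by (simp add: sum.distrib)
  also have "\<dots> = (\<Sum>i\<in>X. if w i = 1 then 2 else 0)"
  proof (rule sum.cong)
    fix i assume "i \<in> X"
    then show "w i + 1 = (if w i = 1 then 2 else 0)" using assms(2)[of i] by auto
  qed simp
  also have "\<dots> = real (2 * card {i \<in> X. w i = 1})"
    using assms(1) by (simp flip: sum.inter_filter)
  finally have "card X = 2 * card {i \<in> X. w i = 1}" by linarith
  then show ?thesis by simp
qed

section \<open>Cycle structure of a 2-regular matrix\<close>

text \<open>With the ones given as a predicate, transposing just swaps two arguments, so column
  versions come from interpreting the locale for the transpose.\<close>

locale two_regular =
  fixes n :: nat and m :: "nat \<Rightarrow> nat \<Rightarrow> bool"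
  assumes card_row: "i < n \<Longrightarrow> card {j. j < n \<and> m i j} = 2"
    and card_col: "j < n \<Longrightarrow> card {i. i < n \<and> m i j} = 2"
begin

definition cols :: "nat \<Rightarrow> nat set" where "cols i = {j. j < n \<and> m i j}"

definition rows :: "nat \<Rightarrow> nat set" where "rows j = {i. i < n \<and> m i j}"

definition adj :: "nat rel" where
  "adj = {(i, i'). i < n \<and> i' < n \<and> (\<exists>j<n. m i j \<and> m i' j)}"

text \<open>Every row has a one, so \<open>adj\<close> is reflexive on \<open>{..<n}\<close> and its
  transitive closure is an equivalence there; \<open>adj\<^sup>*\<close> would also relate indices
  outside to themselves.\<close>

definition comps :: "nat set set" where "comps = {..<n} // adj\<^sup>+"

definition nbh :: "nat set \<Rightarrow> nat set" where "nbh X = (\<Union>i\<in>X. cols i)"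

definition kernel :: "(nat \<Rightarrow> real) \<Rightarrow> bool" where
  "kernel x \<longleftrightarrow> (\<forall>j<n. (\<Sum>i\<in>rows j. x i) = 0)"

text \<open>A component is a cycle, and it carries a kernel vector exactly if its length is even, that is,
  if it is bipartite; only this consequence of bipartiteness is ever needed.\<close>

definition bip :: "nat set \<Rightarrow> bool" where
  "bip K \<longleftrightarrow> (\<exists>x. kernel x \<and> (\<exists>i\<in>K. x i \<noteq> 0))"

lemma transpose: "two_regular n (\<lambda>i j. m j i)"
  using card_row card_col by unfold_locales

lemma finite_cols [simp]: "finite (cols i)" and finite_rows [simp]: "finite (rows j)"
  by (simp_all add: cols_def rows_def)

lemma card_cols: "i < n \<Longrightarrow> card (cols i) = 2"
  and card_rows: "j < n \<Longrightarrow> card (rows j) = 2"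
  using card_row card_col by (simp_all add: cols_def rows_def)

lemma rows_eq: "j < n \<Longrightarrow> i \<in> rows j \<Longrightarrow> i' \<in> rows j \<Longrightarrow> i \<noteq> i' \<Longrightarrow> rows j = {i, i'}"
  using card_subset_eq[of "rows j" "{i, i'}"] card_rows by simp

lemma cols_eq: "i < n \<Longrightarrow> j \<in> cols i \<Longrightarrow> j' \<in> cols i \<Longrightarrow> j \<noteq> j' \<Longrightarrow> cols i = {j, j'}"
  using card_subset_eq[of "cols i" "{j, j'}"] card_cols by simp

lemma cols_nonempty: "i < n \<Longrightarrow> cols i \<noteq> {}"
  using card_cols by fastforce

lemma equiv_adj: "equiv {..<n} (adj\<^sup>+)"
proof -
  have "adj\<^sup>+ \<subseteq> {..<n} \<times> {..<n}" by (rule trancl_subset_Sigma) (auto simp: adj_def)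
  moreover have "(i, i) \<in> adj\<^sup>+" if "i < n" for i
    using cols_nonempty[OF that] that by (auto simp: adj_def cols_def)
  moreover have "sym (adj\<^sup>+)" by (rule sym_trancl) (auto simp: sym_def adj_def)
  ultimately show ?thesis by (auto simp: equiv_def refl_on_def)
qed

lemma finite_comps [simp]: "finite comps"
  unfolding comps_def using equiv_adj by (intro finite_quotient) (auto simp: equiv_def)

lemma Union_comps: "\<Union>comps = {..<n}"
  unfolding comps_def by (rule Union_quotient[OF equiv_adj])

lemma comp_disjoint: "K \<in> comps \<Longrightarrow> K' \<in> comps \<Longrightarrow> i \<in> K \<Longrightarrow> i \<in> K' \<Longrightarrow> K = K'"
  unfolding comps_def using quotient_disj[OF equiv_adj] by blast

lemma comp_subset: "K \<in> comps \<Longrightarrow> K \<subseteq> {..<n}"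
  using Union_comps by blast

lemma finite_comp: "K \<in> comps \<Longrightarrow> finite K"
  using comp_subset finite_subset by blast

lemma comp_nonempty: "K \<in> comps \<Longrightarrow> K \<noteq> {}"
  unfolding comps_def using in_quotient_imp_non_empty[OF equiv_adj] by blast

lemma comp_closed:
  assumes "K \<in> comps" "i \<in> K" "j < n" "m i j" "i' < n" "m i' j" shows "i' \<in> K"
proof -
  have "(i, i') \<in> adj" using assms comp_subset[OF assms(1)] by (auto simp: adj_def)
  then show ?thesis
    using in_quotient_imp_closed[OF equiv_adj, of K i i'] assms by (auto simp: comps_def)
qed

text \<open>Connectedness principle: a property that passes from a row to every row sharing a one
  with it spreads from one row to the whole component.\<close>

lemma comp_minimal:
  assumes K: "K \<in> comps" and X: "X \<subseteq> K" "X \<noteq> {}"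
    and closed: "\<And>i i' j. i \<in> X \<Longrightarrow> j < n \<Longrightarrow> m i j \<Longrightarrow> i' < n \<Longrightarrow> m i' j \<Longrightarrow> i' \<in> X"
  shows "X = K"
proof -
  obtain i where i: "i \<in> X" using X by blast
  have "k \<in> X" if "k \<in> K" for k
  proof -
    have "(i, k) \<in> adj\<^sup>+"
      using in_quotient_imp_in_rel[OF equiv_adj, of K i k] K i that X by (auto simp: comps_def)
    then show ?thesis
      by (induction rule: trancl_induct) (use closed i in \<open>auto simp: adj_def\<close>)
  qed
  with X show ?thesis by blast
qed

section \<open>Kernel vectors along a component\<close>

lemma kernel_opposite:
  assumes "kernel x" "j < n" "i \<in> rows j" "i' \<in> rows j" "i \<noteq> i'"
  shows "x i' = - x i"
proof -
  have "(\<Sum>k\<in>rows j. x k) = x i + x i'" using rows_eq[OF assms(2-5)] assms(5) by simp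
  then show ?thesis using assms(1,2) by (auto simp: kernel_def)
qed

text \<open>The two rows meeting a column carry opposite values, so the absolute value spreads along
  the cycle.\<close>

lemma kernel_abs_constant:
  assumes x: "kernel x" and K: "K \<in> comps" and i: "i \<in> K" "i' \<in> K"
  shows "\<bar>x i'\<bar> = \<bar>x i\<bar>"
proof -
  have "{k \<in> K. \<bar>x k\<bar> = \<bar>x i\<bar>} = K"
  proof (rule comp_minimal[OF K])
    fix k k' j assume a: "k \<in> {k \<in> K. \<bar>x k\<bar> = \<bar>x i\<bar>}" "j < n" "m k j" "k' < n" "m k' j"
    then have "k < n" using comp_subset[OF K] by blast
    then have "\<bar>x k'\<bar> = \<bar>x k\<bar>"
      using kernel_opposite[OF x a(2), of k k'] a by (cases "k = k'") (auto simp: rows_def)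
    then show "k' \<in> {k \<in> K. \<bar>x k\<bar> = \<bar>x i\<bar>}" using a comp_closed[OF K] by auto
  qed (use i in auto)
  with i show ?thesis by blast
qed

text \<open>A kernel vector is divided by its constant absolute value on \<open>K\<close> and cut
  off outside. It stays in the kernel because each column has its two ones either both in rows of
  \<open>K\<close> or both outside.\<close>

lemma sign_vector:
  assumes K: "K \<in> comps" "bip K"
  shows "\<exists>w. kernel w \<and> (\<forall>i\<in>K. \<bar>w i\<bar> = 1) \<and> (\<forall>i. i \<notin> K \<longrightarrow> w i = 0)"
proof -
  obtain x i where x: "kernel x" "i \<in> K" "x i \<noteq> 0" using K by (auto simp: bip_def)
  define w where "w k = (if k \<in> K then x k / \<bar>x i\<bar> else 0)" for k
  have "(\<Sum>k\<in>rows j. w k) = 0" if j: "j < n" for j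
  proof (cases "rows j \<subseteq> K")
    case True
    then have "(\<Sum>k\<in>rows j. w k) = (\<Sum>k\<in>rows j. x k / \<bar>x i\<bar>)"
      by (intro sum.cong) (auto simp: w_def)
    also have "\<dots> = 0" using x(1) j by (simp add: kernel_def flip: sum_divide_distrib)
    finally show ?thesis .
  next
    case False
    then have "rows j \<inter> K = {}" using comp_closed[OF K(1) _ j] by (auto simp: rows_def)
    then show ?thesis by (intro sum.neutral) (auto simp: w_def)
  qed
  then have "kernel w" by (simp add: kernel_def)
  moreover have "\<bar>w k\<bar> = 1" if "k \<in> K" for k
    using kernel_abs_constant[OF x(1) K(1) x(2) that] x(3) that by (simp add: w_def)
  moreover have "w k = 0" if "k \<notin> K" for k using that by (simp add: w_def)
  ultimately show ?thesis by blast
qed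

lemma sum_over_columns: "(\<Sum>j<n. \<Sum>i\<in>rows j. x i) = 2 * (\<Sum>i<n. x i)" for x :: "nat \<Rightarrow> real"
proof -
  have "(\<Sum>j<n. \<Sum>i\<in>rows j. x i) = (\<Sum>j<n. \<Sum>i<n. if m i j then x i else 0)"
    by (intro sum.cong refl sum.mono_neutral_cong_left) (auto simp: rows_def)
  also have "\<dots> = (\<Sum>i<n. \<Sum>j<n. if m i j then x i else 0)" by (rule sum.swap)
  also have "\<dots> = (\<Sum>i<n. \<Sum>j\<in>cols i. x i)"
    by (intro sum.cong refl sum.mono_neutral_cong_right) (auto simp: cols_def)
  also have "\<dots> = 2 * (\<Sum>i<n. x i)" by (simp add: card_cols sum_distrib_left)
  finally show ?thesis .
qed

lemma kernel_sum_zero: "kernel x \<Longrightarrow> (\<Sum>i<n. x i) = 0"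
  using sum_over_columns[of x] by (simp add: kernel_def)

section \<open>Columns reached by a set of rows\<close>

lemma nbh_subset: "nbh X \<subseteq> {..<n}"
  by (auto simp: nbh_def cols_def)

lemma finite_nbh [simp]: "finite (nbh X)"
  using nbh_subset finite_subset by blast

text \<open>Both sides count the ones in the rows of \<open>X\<close>, first by rows and then by
  columns.\<close>

lemma double_count:
  assumes X: "X \<subseteq> {..<n}"
  shows "2 * card X = (\<Sum>j\<in>nbh X. card (rows j \<inter> X))"
proof -
  have "finite X" using X finite_subset by blast
  moreover have "{i \<in> X. m i j} = rows j \<inter> X" for j using X by (auto simp: rows_def)
  ultimately have "(\<Sum>i\<in>X. card {j \<in> nbh X. m i j}) = (\<Sum>j\<in>nbh X. card (rows j \<inter> X))"
    by (intro sum_multicount_gen) auto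
  moreover have "card {j \<in> nbh X. m i j} = 2" if "i \<in> X" for i
  proof -
    have "{j \<in> nbh X. m i j} = cols i" using that by (auto simp: nbh_def cols_def)
    then show ?thesis using card_cols that X by auto
  qed
  ultimately show ?thesis by simp
qed

lemma card_nbh_comp:
  assumes K: "K \<in> comps" shows "card (nbh K) = card K"
proof -
  have "card (rows j \<inter> K) = 2" if "j \<in> nbh K" for j
  proof -
    have "j < n" using nbh_subset that by blast
    then have "rows j \<inter> K = rows j"
      using that comp_closed[OF K] by (auto simp: nbh_def cols_def rows_def)
    then show ?thesis using card_rows \<open>j < n\<close> by simp
  qed
  with double_count[OF comp_subset[OF K]] show ?thesis by simp
qed

text \<open>A proper part of a cycle is not closed, so some column has only one of its two ones in
  \<open>X\<close>; double counting then becomes strict.\<close>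

lemma card_nbh_less:
  assumes K: "K \<in> comps" and X: "X \<subseteq> K" "X \<noteq> {}" "X \<noteq> K"
  shows "card X < card (nbh X)"
proof -
  have sub: "X \<subseteq> {..<n}" using X comp_subset[OF K] by blast
  obtain i i' j where a: "i \<in> X" "j < n" "m i j" "i' < n" "m i' j" "i' \<notin> X"
    using comp_minimal[OF K X(1,2)] X(3) by blast
  have le: "card (rows k \<inter> X) \<le> 2" if "k \<in> nbh X" for k
  proof -
    have "k < n" using nbh_subset that by blast
    then show ?thesis using card_rows[of k] card_mono[of "rows k" "rows k \<inter> X"] by simp
  qed
  have j: "j \<in> nbh X" using a by (auto simp: nbh_def cols_def)
  have "i' \<in> rows j" using a by (auto simp: rows_def)
  then have "rows j \<inter> X \<subset> rows j" using a by blast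
  then have "card (rows j \<inter> X) < 2" using card_rows[OF a(2)] psubset_card_mono[of "rows j"] by simp
  then have "(\<Sum>k\<in>nbh X. card (rows k \<inter> X)) < (\<Sum>k\<in>nbh X. 2)"
    using le j by (intro sum_strict_mono_ex1) auto
  with double_count[OF sub] show ?thesis by simp
qed

text \<open>The block of \<open>K\<close> is square, so its left dependency yields a right one,
  whose entries again have constant absolute value along the cycle.\<close>

lemma column_sign_vector:
  assumes K: "K \<in> comps" "bip K"
  shows "\<exists>w. two_regular.kernel n (\<lambda>i j. m j i) w \<and> (\<forall>j\<in>nbh K. \<bar>w j\<bar> = 1) \<and> (\<forall>j. j \<notin> nbh K \<longrightarrow> w j = 0)"
proof -
  interpret tr: two_regular n "\<lambda>i j. m j i" by (rule transpose)
  have tr_rows: "tr.rows i = cols i" for i by (simp add: tr.rows_def cols_def)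
  obtain v where v: "kernel v" "\<forall>i\<in>K. \<bar>v i\<bar> = 1" "\<forall>i. i \<notin> K \<longrightarrow> v i = 0"
    using sign_vector[OF K] by blast
  obtain k where k: "k \<in> K" using comp_nonempty[OF K(1)] by blast
  have "(\<Sum>i\<in>K. v i * of_bool (m i j)) = 0" if "j \<in> nbh K" for j
  proof -
    have j: "j < n" using nbh_subset that by blast
    have "rows j \<subseteq> K" using that comp_closed[OF K(1)] by (auto simp: nbh_def cols_def rows_def)
    then have "(\<Sum>i\<in>K. v i * of_bool (m i j)) = (\<Sum>i\<in>rows j. v i)"
      using comp_subset[OF K(1)] finite_comp[OF K(1)]
      by (intro sum.mono_neutral_cong_right) (auto simp: rows_def)
    then show ?thesis using v(1) j by (simp add: kernel_def)
  qed
  moreover have "v k \<noteq> 0" using v(2) k by auto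
  \<comment> \<open>Rows of \<open>K\<close> are the equations and columns of \<open>nbh K\<close>
    the unknowns, in equal number; \<open>v\<close> makes one equation redundant.\<close>
  ultimately have "\<exists>x. (\<exists>j\<in>nbh K. x j \<noteq> 0) \<and> (\<forall>j. j \<notin> nbh K \<longrightarrow> x j = 0) \<and>
      (\<forall>i\<in>K. (\<Sum>j\<in>nbh K. x j * of_bool (m i j)) = (0::real))"
    using card_nbh_comp[OF K(1)] finite_comp[OF K(1)] k
    by (intro dependent_homogeneous_system_nontrivial[where u = v and s = k]) auto
  then obtain x l where x: "l \<in> nbh K" "x l \<noteq> 0" "\<forall>j. j \<notin> nbh K \<longrightarrow> x j = 0"
    "\<forall>i\<in>K. (\<Sum>j\<in>nbh K. x j * of_bool (m i j)) = (0::real)" by blast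
  have "(\<Sum>j\<in>cols i. x j) = 0" if i: "i < n" for i
  proof (cases "i \<in> K")
    case True
    then have "cols i \<subseteq> nbh K" by (auto simp: nbh_def)
    then have "(\<Sum>j\<in>cols i. x j) = (\<Sum>j\<in>nbh K. x j * of_bool (m i j))"
      using nbh_subset[of K] by (intro sum.mono_neutral_cong_left) (auto simp: cols_def)
    then show ?thesis using x(4) True by simp
  next
    case False
    then have "cols i \<inter> nbh K = {}" using comp_closed[OF K(1)] i by (auto simp: nbh_def cols_def)
    then show ?thesis using x(3) by (intro sum.neutral) auto
  qed
  then have ker: "tr.kernel x" by (simp add: tr.kernel_def tr_rows)
  have eq: "\<bar>x j'\<bar> = \<bar>x j\<bar>" if "i < n" "j \<in> cols i" "j' \<in> cols i" for i j j'
    using tr.kernel_opposite[OF ker that(1), of j j'] that by (cases "j = j'") (auto simp: tr_rows)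
  obtain i0 where i0: "i0 \<in> K" "l \<in> cols i0" using x(1) by (auto simp: nbh_def)
  \<comment> \<open>The components of the transpose have not been related to \<open>nbh K\<close>,
    so the absolute value is propagated through the rows of \<open>K\<close> instead.\<close>
  have "{i \<in> K. \<forall>j\<in>cols i. \<bar>x j\<bar> = \<bar>x l\<bar>} = K"
  proof (rule comp_minimal[OF K(1)])
    show "{i \<in> K. \<forall>j\<in>cols i. \<bar>x j\<bar> = \<bar>x l\<bar>} \<noteq> {}"
      using i0 eq[of i0 l] comp_subset[OF K(1)] by blast
  next
    fix i i' j assume a: "i \<in> {i \<in> K. \<forall>j\<in>cols i. \<bar>x j\<bar> = \<bar>x l\<bar>}" "j < n" "m i j" "i' < n" "m i' j"
    have "i' \<in> K" using comp_closed[OF K(1)] a by blast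
    moreover have j: "j \<in> cols i" "j \<in> cols i'" using a(2,3,5) by (simp_all add: cols_def)
    moreover from a(1) j(1) have "\<bar>x j\<bar> = \<bar>x l\<bar>" by blast
    then have "\<forall>j'\<in>cols i'. \<bar>x j'\<bar> = \<bar>x l\<bar>" using eq[OF a(4) j(2)] by metis
    ultimately show "i' \<in> {i \<in> K. \<forall>j\<in>cols i. \<bar>x j\<bar> = \<bar>x l\<bar>}" by blast
  qed blast
  then have abs: "\<bar>x j\<bar> = \<bar>x l\<bar>" if "j \<in> nbh K" for j using that unfolding nbh_def by blast
  define w where "w j = x j / \<bar>x l\<bar>" for j
  have "tr.kernel w" using ker by (simp add: tr.kernel_def w_def flip: sum_divide_distrib)
  moreover have "\<bar>w j\<bar> = 1" if "j \<in> nbh K" for j using abs[OF that] x(2) by (simp add: w_def)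
  moreover have "w j = 0" if "j \<notin> nbh K" for j using x(3) that by (simp add: w_def)
  ultimately show ?thesis by blast
qed

section \<open>Bipartite components and their representatives\<close>

definition bips :: "nat set set" where "bips = {K \<in> comps. bip K}"

definition rep :: "nat set \<Rightarrow> nat" where "rep K = (SOME i. i \<in> K)"

lemma bipsD: "K \<in> bips \<Longrightarrow> K \<in> comps" "K \<in> bips \<Longrightarrow> bip K"
  by (simp_all add: bips_def)

lemma finite_bips [simp]: "finite bips"
  by (simp add: bips_def)

lemma comp_of: "i < n \<Longrightarrow> \<exists>K\<in>comps. i \<in> K"
  using Union_comps by (metis UnionE lessThan_iff)

lemma rep_in: "K \<in> comps \<Longrightarrow> rep K \<in> K"
  unfolding rep_def using comp_nonempty by (simp add: some_in_eq)

lemma inj_on_rep: "inj_on rep comps"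
  by (rule inj_onI) (metis comp_disjoint rep_in)

lemma card_Diff_reps:
  assumes "\<K> \<subseteq> comps"
  shows "card ({..<n} - rep ` \<K>) = n - card \<K>" "card \<K> \<le> n"
proof -
  have fin: "finite \<K>" using assms finite_comps finite_subset by blast
  have sub: "rep ` \<K> \<subseteq> {..<n}" using assms rep_in comp_subset by blast
  have card: "card (rep ` \<K>) = card \<K>" using inj_on_rep assms inj_on_subset card_image by blast
  show "card ({..<n} - rep ` \<K>) = n - card \<K>"
    using card_Diff_subset[of "rep ` \<K>" "{..<n}"] fin sub card by simp
  show "card \<K> \<le> n" using card_mono[OF _ sub] card by simp
qed

text \<open>By constancy of the absolute value, one zero kills a kernel vector on a bipartite
  component; on the other components it vanishes anyway. Hence the values at representatives of
  bipartite components determine it.\<close>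

lemma kernel_vanishes:
  assumes x: "kernel x" and K: "K \<in> comps" and zero: "K \<in> bips \<Longrightarrow> x (rep K) = 0" and i: "i \<in> K"
  shows "x i = 0"
proof (cases "bip K")
  case True
  then have "x (rep K) = 0" using zero K by (simp add: bips_def)
  then show ?thesis using kernel_abs_constant[OF x K rep_in[OF K] i] by simp
next
  case False
  then show ?thesis using x i by (auto simp: bip_def)
qed

text \<open>The total weight of any kernel vector is zero, so the signs on \<open>K\<close>
  cancel.\<close>

lemma even_card_bip:
  assumes "K \<in> bips" shows "even (card K)"
proof -
  note K = bipsD[OF assms]
  obtain w where w: "kernel w" "\<forall>i\<in>K. \<bar>w i\<bar> = 1" "\<forall>i. i \<notin> K \<longrightarrow> w i = 0"
    using sign_vector[OF K] by blast
  have "(\<Sum>i\<in>K. w i) = (\<Sum>i<n. w i)"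
    using w(3) comp_subset[OF K(1)] by (intro sum.mono_neutral_left) auto
  also have "\<dots> = 0" by (rule kernel_sum_zero[OF w(1)])
  finally show ?thesis using even_card_if_signs_cancel[of K w] w(2) finite_comp[OF K(1)] by simp
qed

section \<open>Repeated rows and components of size two\<close>

text \<open>Two equal rows use up both ones of each of their columns, so no third row is adjacent to
  them.\<close>

lemma twin_rows:
  assumes K: "K \<in> comps" "i \<in> K" and i': "i' < n" "cols i = cols i'" "i \<noteq> i'"
  shows "K = {i, i'}"
proof -
  have i: "i < n" using K comp_subset by blast
  obtain j where j: "j < n" "m i j" "m i' j"
    using cols_nonempty[OF i] i'(2) by (auto simp: cols_def)
  have "{i, i'} = K"
  proof (rule comp_minimal[OF K(1)])
    show "{i, i'} \<subseteq> K" using comp_closed[OF K j(1,2) i'(1) j(3)] K by simp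
  next
    fix k k' l assume a: "k \<in> {i, i'}" "l < n" "m k l" "k' < n" "m k' l"
    then have "l \<in> cols i" using i' by (auto simp: cols_def)
    then have "i \<in> rows l" "i' \<in> rows l" using i i' by (auto simp: rows_def cols_def)
    then have "rows l = {i, i'}" using rows_eq a i' by blast
    then show "k' \<in> {i, i'}" using a by (auto simp: rows_def)
  qed simp
  then show ?thesis by simp
qed

text \<open>Two equal columns make the two rows meeting them equal, which reduces the claim to
  \<open>twin_rows\<close>.\<close>

lemma twin_cols:
  assumes K: "K \<in> comps" "j \<in> nbh K" and j': "j' < n" "rows j = rows j'" "j \<noteq> j'"
  shows "card K = 2"
proof -
  have j: "j < n" using K nbh_subset by blast
  then obtain i i' where i: "rows j = {i, i'}" "i \<noteq> i'" using card_rows card_2_iff by metis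
  then have lt: "i < n" "i' < n" by (auto simp: rows_def)
  have "j \<in> cols k" "j' \<in> cols k" if "k \<in> rows j" for k
    using that j j'(1) that[unfolded j'(2)] by (simp_all add: rows_def cols_def)
  then have "cols i = {j, j'}" "cols i' = {j, j'}" using cols_eq lt j'(3) i by blast+
  moreover have "i \<in> K"
  proof -
    obtain k where k: "k \<in> K" "j \<in> cols k" using K by (auto simp: nbh_def)
    have "i \<in> rows j" using i by simp
    with k show ?thesis using comp_closed[OF K(1) k(1) j, of i] by (auto simp: rows_def cols_def)
  qed
  ultimately have "K = {i, i'}" using twin_rows[OF K(1)] lt i by simp
  then show ?thesis using i by simp
qed

lemma twin_comp:
  assumes K: "K \<in> comps" "card K = 2" and i: "i \<in> K"
  shows "cols i = nbh K"
proof (rule card_subset_eq)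
  show "cols i \<subseteq> nbh K" using i by (auto simp: nbh_def)
  show "card (cols i) = card (nbh K)"
    using card_cols card_nbh_comp[OF K(1)] K(2) i comp_subset[OF K(1)] by auto
qed simp

text \<open>In a component of size two the representative repeats the other row, so omitting it
  loses no distinct row.\<close>

lemma card_distinct_rows:
  "card (cols ` {..<n}) \<le> n - card {K \<in> bips. card K = 2}"
proof -
  define \<K> where "\<K> = {K \<in> bips. card K = 2}"
  have sub: "\<K> \<subseteq> comps" by (auto simp: \<K>_def bips_def)
  have "cols ` {..<n} \<subseteq> cols ` ({..<n} - rep ` \<K>)"
  proof
    fix C assume "C \<in> cols ` {..<n}"
    then obtain i where i: "i < n" "C = cols i" by blast
    show "C \<in> cols ` ({..<n} - rep ` \<K>)"
    proof (cases "i \<in> rep ` \<K>")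
      case True
      then obtain K where K: "K \<in> \<K>" "i = rep K" by blast
      then have c: "K \<in> comps" "card K = 2" by (auto simp: \<K>_def bips_def)
      have "i \<in> K" using K rep_in[OF c(1)] by simp
      obtain i' where i': "i' \<in> K" "i' \<noteq> i" using c(2) \<open>i \<in> K\<close> by (auto simp: card_2_iff)
      have "i' \<notin> rep ` \<K>"
      proof
        assume "i' \<in> rep ` \<K>"
        then obtain K' where K': "K' \<in> \<K>" "i' = rep K'" by blast
        then have "K' = K" using comp_disjoint[of K' K i'] rep_in[of K'] sub c(1) i' by auto
        then show False using K' K i' by simp
      qed
      moreover have "cols i' = cols i" using twin_comp[OF c] \<open>i \<in> K\<close> i' by simp
      ultimately show ?thesis using i i' comp_subset[OF c(1)] by (intro image_eqI[of _ _ i']) auto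
    qed (use i in auto)
  qed
  then have "card (cols ` {..<n}) \<le> card ({..<n} - rep ` \<K>)"
    using surj_card_le[of "{..<n} - rep ` \<K>" "cols ` {..<n}" cols] by simp
  then show ?thesis using card_Diff_reps[OF sub] by (simp add: \<K>_def)
qed

lemma sum_card_bips: "(\<Sum>K\<in>bips. card K) \<le> n"
proof -
  have "(\<Sum>K\<in>bips. card K) = card (\<Union>bips)"
    using bipsD finite_comp comp_disjoint
    by (intro card_Union_disjoint[symmetric]) (auto simp: pairwise_def disjnt_def, blast+)
  also have "\<dots> \<le> card {..<n}" using bipsD comp_subset by (intro card_mono) auto
  finally show ?thesis by simp
qed

end

section \<open>Rectangle partitions of the complement\<close>

text \<open>Describing the partition cell by cell keeps it symmetric in \<open>I\<close> and
  \<open>J\<close>, so transposition exchanges them. The bound \<open>3 \<le> n\<close> makes the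
  factor \<open>n - 2\<close> in \<open>annihilator_kernel\<close> nonzero.\<close>

locale complement_cover = two_regular +
  fixes T :: "'t set" and I J :: "'t \<Rightarrow> nat set"
  assumes finite_T: "finite T" and n_ge_3: "3 \<le> n"
    and I_subset: "t \<in> T \<Longrightarrow> I t \<subseteq> {..<n}" and J_subset: "t \<in> T \<Longrightarrow> J t \<subseteq> {..<n}"
    and cell: "i < n \<Longrightarrow> j < n \<Longrightarrow> card {t \<in> T. i \<in> I t \<and> j \<in> J t} = (if m i j then 0 else 1)"
begin

lemma transpose_cover: "complement_cover n (\<lambda>i j. m j i) T J I"
proof -
  interpret tr: two_regular n "\<lambda>i j. m j i" by (rule transpose)
  have "card {t \<in> T. i \<in> J t \<and> j \<in> I t} = (if m j i then 0 else 1)" if "i < n" "j < n" for i j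
    using cell[OF that(2,1)] by (simp only: conj_commute)
  then show ?thesis using finite_T n_ge_3 I_subset J_subset by unfold_locales
qed

lemma finite_I: "t \<in> T \<Longrightarrow> finite (I t)" and finite_J: "t \<in> T \<Longrightarrow> finite (J t)"
  by (meson I_subset J_subset finite_lessThan finite_subset)+

text \<open>The rectangles through column \<open>j\<close> have row sets that partition the rows
  with a zero there.\<close>

lemma cover_sum:
  fixes x :: "nat \<Rightarrow> real"
  assumes j: "j < n"
  shows "(\<Sum>t\<in>{t \<in> T. j \<in> J t}. \<Sum>i\<in>I t. x i) = (\<Sum>i<n. x i) - (\<Sum>i\<in>rows j. x i)"
proof -
  have "(\<Sum>t\<in>{t \<in> T. j \<in> J t}. \<Sum>i\<in>I t. x i)
      = (\<Sum>t\<in>{t \<in> T. j \<in> J t}. \<Sum>i<n. if i \<in> I t then x i else 0)"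
    using I_subset by (intro sum.cong refl sum.mono_neutral_cong_left) auto
  also have "\<dots> = (\<Sum>i<n. \<Sum>t\<in>{t \<in> T. j \<in> J t}. if i \<in> I t then x i else 0)" by (rule sum.swap)
  also have "\<dots> = (\<Sum>i<n. \<Sum>t\<in>{t \<in> T. i \<in> I t \<and> j \<in> J t}. x i)"
    using finite_T by (intro sum.cong refl sum.mono_neutral_cong_right) auto
  also have "\<dots> = (\<Sum>i<n. x i - (if m i j then x i else 0))"
    using j by (intro sum.cong) (auto simp: cell)
  also have "\<dots> = (\<Sum>i<n. x i) - (\<Sum>i<n. if m i j then x i else 0)" by (rule sum_subtractf)
  also have "(\<Sum>i<n. if m i j then x i else 0) = (\<Sum>i\<in>rows j. x i)"
    by (intro sum.mono_neutral_cong_right) (auto simp: rows_def)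
  finally show ?thesis .
qed

text \<open>Regularity enters here: summing over all columns shows that the total weight of an
  annihilator of the complement is zero, so that it also annihilates the matrix itself.\<close>

lemma annihilator_kernel:
  assumes x: "\<And>t. t \<in> T \<Longrightarrow> (\<Sum>i\<in>I t. x i) = 0"
  shows "kernel x"
proof -
  have eq: "(\<Sum>i\<in>rows j. x i) = (\<Sum>i<n. x i)" if "j < n" for j
    using cover_sum[OF that, of x] x by simp
  have "2 * (\<Sum>i<n. x i) = (\<Sum>j<n. \<Sum>i\<in>rows j. x i)" by (simp add: sum_over_columns)
  also have "\<dots> = real n * (\<Sum>i<n. x i)" using eq by simp
  finally have "(real n - 2) * (\<Sum>i<n. x i) = 0" by (simp add: algebra_simps)
  then have "(\<Sum>i<n. x i) = 0" using n_ge_3 by simp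
  then show ?thesis using eq by (simp add: kernel_def)
qed

lemma restricted_sum:
  fixes x :: "nat \<Rightarrow> real"
  assumes "finite S" "t \<in> T" "\<forall>i. i \<notin> S \<longrightarrow> x i = 0"
  shows "(\<Sum>i\<in>S. x i * of_bool (i \<in> I t)) = (\<Sum>i\<in>I t. x i)"
proof -
  have "(\<Sum>i\<in>S. x i * of_bool (i \<in> I t)) = (\<Sum>i\<in>S \<inter> I t. x i)"
    using assms by (intro sum.mono_neutral_cong_right) auto
  also have "\<dots> = (\<Sum>i\<in>I t. x i)"
    using assms finite_I by (intro sum.mono_neutral_left) auto
  finally show ?thesis .
qed

section \<open>The rank bound and its tight case\<close>

lemma kernel_vector_on:
  assumes S: "finite S" "card T < card S"
  shows "\<exists>x. kernel x \<and> (\<exists>i\<in>S. x i \<noteq> 0) \<and> (\<forall>i. i \<notin> S \<longrightarrow> x i = 0) \<and> (\<forall>t\<in>T. (\<Sum>i\<in>I t. x i) = 0)"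
proof -
  obtain x :: "nat \<Rightarrow> real" where x: "\<exists>i\<in>S. x i \<noteq> 0" "\<forall>i. i \<notin> S \<longrightarrow> x i = 0"
    "\<forall>t\<in>T. (\<Sum>i\<in>S. x i * of_bool (i \<in> I t)) = 0"
    using homogeneous_system_nontrivial[OF finite_T S, of "\<lambda>i t. of_bool (i \<in> I t)"] by blast
  have "\<forall>t\<in>T. (\<Sum>i\<in>I t. x i) = 0" using x(3) restricted_sum[OF S(1) _ x(2)] by simp
  then show ?thesis using x annihilator_kernel by blast
qed

lemma kernel_zero_off_reps:
  assumes "kernel x" "\<forall>i. i \<notin> {..<n} - rep ` bips \<longrightarrow> x i = 0" shows "x i = 0"
proof (cases "i < n")
  case True
  then obtain K where K: "K \<in> comps" "i \<in> K" using comp_of by blast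
  show ?thesis using kernel_vanishes[OF assms(1) K(1) _ K(2)] assms(2) by blast
qed (use assms in auto)

text \<open>With fewer rectangles, some nonzero vector supported off the representatives would
  annihilate all of them. It would lie in the kernel and vanish at every representative, hence
  everywhere.\<close>

lemma rank_bound: "n \<le> card T + card bips"
proof (rule ccontr)
  have sub: "bips \<subseteq> comps" by (auto simp: bips_def)
  assume "\<not> n \<le> card T + card bips"
  then have "card T < card ({..<n} - rep ` bips)" using card_Diff_reps[OF sub] by simp
  then show False using kernel_vector_on[of "{..<n} - rep ` bips"] kernel_zero_off_reps by blast
qed

text \<open>Readmitting the single representative of \<open>K\<close> gives more unknowns than
  rectangles. The resulting annihilator is a kernel vector living on \<open>K\<close>, hence
  proportional to \<open>w\<close>.\<close>

lemma rows_balanced: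
  assumes tight: "card T + card bips \<le> n" and K: "K \<in> bips"
    and w: "kernel w" "\<forall>i. i \<notin> K \<longrightarrow> w i = 0" and t: "t \<in> T"
  shows "(\<Sum>i\<in>I t. w i) = 0"
proof -
  define S where "S = insert (rep K) ({..<n} - rep ` bips)"
  have sub: "bips \<subseteq> comps" by (auto simp: bips_def)
  note Kc = bipsD(1)[OF K]
  have "card S = Suc (n - card bips)"
    unfolding S_def using card_Diff_reps[OF sub] K by simp
  then have "card T < card S" using tight by simp
  then obtain x where x: "kernel x" "\<exists>i\<in>S. x i \<noteq> 0" "\<forall>i. i \<notin> S \<longrightarrow> x i = 0"
    "\<forall>t\<in>T. (\<Sum>i\<in>I t. x i) = 0" using kernel_vector_on[of S] by (auto simp: S_def)
  have other: "x (rep K') = 0" if "K' \<in> bips" "K' \<noteq> K" for K'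
  proof -
    have "rep K' \<noteq> rep K" using that inj_on_rep bipsD(1) Kc by (auto simp: inj_on_def)
    then show ?thesis using x(3) that by (auto simp: S_def)
  qed
  have "x (rep K) \<noteq> 0"
  proof
    assume "x (rep K) = 0"
    then have "\<forall>i. i \<notin> {..<n} - rep ` bips \<longrightarrow> x i = 0"
      using x(3) unfolding S_def by (metis insert_iff)
    then show False using kernel_zero_off_reps[OF x(1)] x(2) by blast
  qed
  \<comment> \<open>\<open>c\<close> makes \<open>y\<close> vanish at the representative of
    \<open>K\<close>; at the other bipartite representatives both \<open>w\<close> and
    \<open>x\<close> are zero.\<close>
  define c where "c = w (rep K) / x (rep K)"
  define y where "y i = w i - c * x i" for i
  have ky: "kernel y"
    using w(1) x(1) by (simp add: kernel_def y_def sum_subtractf flip: sum_distrib_left)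
  have "y i = 0" if "i < n" for i
  proof -
    obtain K' where K': "K' \<in> comps" "i \<in> K'" using comp_of[OF \<open>i < n\<close>] by blast
    have "y (rep K') = 0" if b: "K' \<in> bips"
    proof (cases "K' = K")
      case True
      then show ?thesis using \<open>x (rep K) \<noteq> 0\<close> by (simp add: y_def c_def)
    next
      case False
      then have "rep K' \<notin> K" using comp_disjoint[OF K'(1) Kc rep_in[OF K'(1)]] by blast
      then show ?thesis using other[OF b False] w(2) by (simp add: y_def)
    qed
    then show ?thesis using kernel_vanishes[OF ky K'(1) _ K'(2)] by blast
  qed
  then have "w i = c * x i" if "i \<in> I t" for i
    using that I_subset[OF t] unfolding y_def by force
  then have "(\<Sum>i\<in>I t. w i) = c * (\<Sum>i\<in>I t. x i)" by (simp add: sum_distrib_left)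
  then show ?thesis using x(4) t by simp
qed

text \<open>Tightness counts row components, so this is not a plain transposition of
  \<open>rows_balanced\<close>. A right kernel vector with some nonzero sum over a
  \<open>J s\<close> makes the rectangle equations dependent; the freed equation would yield a
  nonzero kernel vector off the representatives.\<close>

lemma cols_balanced:
  assumes tight: "card T + card bips \<le> n"
    and w: "two_regular.kernel n (\<lambda>i j. m j i) w" and s: "s \<in> T"
  shows "(\<Sum>j\<in>J s. w j) = 0"
proof (rule ccontr)
  interpret tr: complement_cover n "\<lambda>i j. m j i" T J I by (rule transpose_cover)
  assume ns: "(\<Sum>j\<in>J s. w j) \<noteq> 0"
  define S where "S = {..<n} - rep ` bips"
  have sub: "bips \<subseteq> comps" by (auto simp: bips_def)
  have "card T \<le> card S" unfolding S_def using card_Diff_reps[OF sub] tight by simp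
  \<comment> \<open>By the transposed \<open>cover_sum\<close>, \<open>w\<close> annihilates the
    complement from the right.\<close>
  moreover have "(\<Sum>t\<in>T. (\<Sum>j\<in>J t. w j) * of_bool (i \<in> I t)) = 0" if "i \<in> S" for i
  proof -
    have i: "i < n" using that by (simp add: S_def)
    have "(\<Sum>t\<in>T. (\<Sum>j\<in>J t. w j) * of_bool (i \<in> I t)) = (\<Sum>t\<in>{t \<in> T. i \<in> I t}. \<Sum>j\<in>J t. w j)"
      using finite_T by (intro sum.mono_neutral_cong_right) auto
    also have "\<dots> = 0"
      using tr.cover_sum[OF i, of w] tr.kernel_sum_zero[OF w] w i by (simp add: tr.kernel_def)
    finally show ?thesis .
  qed
  ultimately obtain x :: "nat \<Rightarrow> real" where x: "\<exists>i\<in>S. x i \<noteq> 0" "\<forall>i. i \<notin> S \<longrightarrow> x i = 0"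
    "\<forall>t\<in>T. (\<Sum>i\<in>S. x i * of_bool (i \<in> I t)) = 0"
    using dependent_homogeneous_system_nontrivial[OF finite_T, of S s "\<lambda>t. \<Sum>j\<in>J t. w j"
        "\<lambda>i t. of_bool (i \<in> I t)"] s ns by (auto simp: S_def)
  have "finite S" by (simp add: S_def)
  then have "kernel x" using x(2,3) restricted_sum annihilator_kernel by simp
  then show False using kernel_zero_off_reps x(1,2) unfolding S_def by blast
qed

section \<open>Counting cells covered by rectangles\<close>

text \<open>In column \<open>j\<close>, each row of \<open>X\<close> is accounted for once: by a
  rectangle if the entry is zero, by \<open>rows j\<close> if it is a one.\<close>

lemma col_count:
  assumes "j < n" "X \<subseteq> {..<n}"
  shows "(\<Sum>t\<in>{t \<in> T. j \<in> J t}. card (I t \<inter> X)) + card (rows j \<inter> X) = card X"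
proof -
  have fin: "finite X" using assms finite_subset by blast
  have "(\<Sum>t\<in>{t \<in> T. j \<in> J t}. card {i \<in> X. i \<in> I t}) = (\<Sum>i\<in>X. if m i j then 0 else 1)"
  proof (rule sum_multicount_gen)
    show "\<forall>i\<in>X. card {t \<in> {t \<in> T. j \<in> J t}. i \<in> I t} = (if m i j then 0 else 1)"
    proof
      fix i assume "i \<in> X"
      then have "i < n" using assms by blast
      moreover have "{t \<in> {t \<in> T. j \<in> J t}. i \<in> I t} = {t \<in> T. i \<in> I t \<and> j \<in> J t}" by blast
      ultimately show "card {t \<in> {t \<in> T. j \<in> J t}. i \<in> I t} = (if m i j then 0 else 1)"
        using cell assms(1) by presburger
    qed
  qed (use finite_T fin in auto)
  moreover have "card (rows j \<inter> X) = (\<Sum>i\<in>X. if m i j then 1 else 0)"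
  proof -
    have "rows j \<inter> X = {i \<in> X. m i j}" using assms by (auto simp: rows_def)
    then show ?thesis using fin by (simp flip: sum.inter_filter)
  qed
  moreover have "{i \<in> X. i \<in> I t} = I t \<inter> X" for t by blast
  ultimately have "(\<Sum>t\<in>{t \<in> T. j \<in> J t}. card (I t \<inter> X)) + card (rows j \<inter> X)
      = (\<Sum>i\<in>X. (if m i j then 0 else 1) + (if m i j then 1 else 0))"
    by (simp add: sum.distrib)
  also have "\<dots> = (\<Sum>i\<in>X. 1)" by (intro sum.cong) auto
  finally show ?thesis by simp
qed

lemma row_count:
  assumes "i < n" "Y \<subseteq> {..<n}"
  shows "(\<Sum>t\<in>{t \<in> T. i \<in> I t}. card (J t \<inter> Y)) + card (cols i \<inter> Y) = card Y"
proof -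
  interpret tr: complement_cover n "\<lambda>i j. m j i" T J I by (rule transpose_cover)
  show ?thesis using tr.col_count[OF assms] by (simp add: tr.rows_def cols_def)
qed

lemma row_count_comp:
  assumes "K \<in> comps" "i \<in> K"
  shows "(\<Sum>t\<in>{t \<in> T. i \<in> I t}. card (J t \<inter> nbh K)) + 2 = card K"
proof -
  have i: "i < n" using assms comp_subset by blast
  have "cols i \<inter> nbh K = cols i" using assms by (auto simp: nbh_def)
  then show ?thesis
    using row_count[OF i nbh_subset, of K] card_cols[OF i] card_nbh_comp[OF assms(1)] by simp
qed

text \<open>Summing \<open>row_count_comp\<close> over \<open>K\<close> counts the zeros of the
  block by rectangles.\<close>

lemma area_count:
  assumes K: "K \<in> comps"
  shows "(\<Sum>t\<in>T. card (I t \<inter> K) * card (J t \<inter> nbh K)) + 2 * card K = card K * card K"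
proof -
  have "(\<Sum>i\<in>K. \<Sum>t\<in>{t \<in> T. i \<in> I t}. card (J t \<inter> nbh K))
      = (\<Sum>t\<in>T. \<Sum>i\<in>{i \<in> K. i \<in> I t}. card (J t \<inter> nbh K))"
    by (rule sum.swap_restrict[OF finite_comp[OF K] finite_T])
  also have "\<dots> = (\<Sum>t\<in>T. card (I t \<inter> K) * card (J t \<inter> nbh K))"
    by (intro sum.cong) (auto simp: Int_def conj_commute)
  finally have "(\<Sum>t\<in>T. card (I t \<inter> K) * card (J t \<inter> nbh K)) + 2 * card K
      = (\<Sum>i\<in>K. (\<Sum>t\<in>{t \<in> T. i \<in> I t}. card (J t \<inter> nbh K)) + 2)"
    by (subst sum.distrib) simp
  also have "\<dots> = (\<Sum>i\<in>K. card K)" using row_count_comp[OF K] by (intro sum.cong) auto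
  finally show ?thesis by simp
qed

section \<open>Rectangles inside a bipartite block\<close>

text \<open>Parity: the sign vectors of the block sum to zero over each rectangle. Size:
  \<open>J t\<close> avoids every column reached from \<open>I t \<inter> K\<close>, and a proper
  part of the cycle reaches more columns than it has rows.\<close>

lemma block_rectangle:
  assumes tight: "card T + card bips \<le> n" and K: "K \<in> bips" and t: "t \<in> T"
  shows "even (card (I t \<inter> K))" "even (card (J t \<inter> nbh K))"
    "I t \<inter> K \<noteq> {} \<Longrightarrow> J t \<inter> nbh K \<noteq> {} \<Longrightarrow> card (I t \<inter> K) + card (J t \<inter> nbh K) < card K"
proof -
  note Kc = bipsD(1)[OF K]
  obtain w where w: "kernel w" "\<forall>i\<in>K. \<bar>w i\<bar> = 1" "\<forall>i. i \<notin> K \<longrightarrow> w i = 0"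
    using sign_vector[OF bipsD[OF K]] by blast
  have "(\<Sum>i\<in>I t \<inter> K. w i) = (\<Sum>i\<in>I t. w i)"
    using w(3) finite_I[OF t] by (intro sum.mono_neutral_left) auto
  then show "even (card (I t \<inter> K))"
    using rows_balanced[OF tight K w(1,3) t] w(2) finite_I[OF t]
    by (intro even_card_if_signs_cancel[of _ w]) auto
  obtain v where v: "two_regular.kernel n (\<lambda>i j. m j i) v" "\<forall>j\<in>nbh K. \<bar>v j\<bar> = 1"
    "\<forall>j. j \<notin> nbh K \<longrightarrow> v j = 0"
    using column_sign_vector[OF bipsD[OF K]] by blast
  have "(\<Sum>j\<in>J t \<inter> nbh K. v j) = (\<Sum>j\<in>J t. v j)"
    using v(3) finite_J[OF t] by (intro sum.mono_neutral_left) auto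
  then show "even (card (J t \<inter> nbh K))"
    using cols_balanced[OF tight v(1) t] v(2) finite_J[OF t]
    by (intro even_card_if_signs_cancel[of _ v]) auto
  have disj: "nbh (I t \<inter> K) \<inter> (J t \<inter> nbh K) = {}"
  proof (rule ccontr)
    assume "\<not> ?thesis"
    then obtain i j where ij: "i \<in> I t" "j \<in> J t" "m i j" "i < n" "j < n"
      using I_subset[OF t] by (auto simp: nbh_def cols_def)
    then have "{t \<in> T. i \<in> I t \<and> j \<in> J t} = {}" using cell[of i j] finite_T by simp
    then show False using ij t by blast
  qed
  assume ne: "I t \<inter> K \<noteq> {}" "J t \<inter> nbh K \<noteq> {}"
  have "I t \<inter> K \<noteq> K" using disj ne(2) by force
  then have "card (I t \<inter> K) < card (nbh (I t \<inter> K))" using ne by (intro card_nbh_less[OF Kc]) auto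
  moreover have "card (nbh (I t \<inter> K)) + card (J t \<inter> nbh K) \<le> card (nbh K)"
  proof -
    have "card (nbh (I t \<inter> K)) + card (J t \<inter> nbh K) = card (nbh (I t \<inter> K) \<union> (J t \<inter> nbh K))"
      using disj by (intro card_Un_disjoint[symmetric]) auto
    also have "\<dots> \<le> card (nbh K)" by (intro card_mono finite_nbh) (auto simp: nbh_def)
    finally show ?thesis .
  qed
  ultimately show "card (I t \<inter> K) + card (J t \<inter> nbh K) < card K" using card_nbh_comp[OF Kc] by simp
qed

text \<open>Two positive even numbers add up to at least 4, so no rectangle could cover any of the
  eight zeros of the block.\<close>

lemma no_four_block:
  assumes tight: "card T + card bips \<le> n" and K: "K \<in> bips"
  shows "card K \<noteq> 4"
proof
  assume four: "card K = 4"
  have "card (I t \<inter> K) * card (J t \<inter> nbh K) = 0" if t: "t \<in> T" for t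
  proof (rule ccontr)
    assume "\<not> ?thesis"
    then have *: "card (I t \<inter> K) \<noteq> 0" "card (J t \<inter> nbh K) \<noteq> 0" by auto
    then have "I t \<inter> K \<noteq> {}" "J t \<inter> nbh K \<noteq> {}" by force+
    then have "card (I t \<inter> K) + card (J t \<inter> nbh K) < 4"
      using block_rectangle(3)[OF tight K t] four by simp
    moreover have "a + b \<ge> 4" if "even a" "even b" "a \<noteq> 0" "b \<noteq> 0" for a b :: nat
      using that by presburger
    ultimately show False using block_rectangle(1,2)[OF tight K t] * by fastforce
  qed
  then have "(\<Sum>t\<in>T. card (I t \<inter> K) * card (J t \<inter> nbh K)) = 0" by (intro sum.neutral) blast
  then show False using area_count[OF bipsD(1)[OF K]] four by simp
qed

lemma six_block_rectangle:
  assumes tight: "card T + card bips \<le> n" and K: "K \<in> bips" "card K = 6" and t: "t \<in> T"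
  shows "card (I t \<inter> K) * card (J t \<inter> nbh K) = 0 \<or> card (I t \<inter> K) = 2 \<and> card (J t \<inter> nbh K) = 2"
proof (rule ccontr)
  assume a: "\<not> ?thesis"
  then have *: "card (I t \<inter> K) \<noteq> 0" "card (J t \<inter> nbh K) \<noteq> 0" by auto
  then have "I t \<inter> K \<noteq> {}" "J t \<inter> nbh K \<noteq> {}" by force+
  then have "card (I t \<inter> K) + card (J t \<inter> nbh K) < 6"
    using block_rectangle(3)[OF tight K(1) t] K(2) by simp
  moreover have "a = 2 \<and> b = 2" if "even a" "even b" "a \<noteq> 0" "b \<noteq> 0" "a + b < 6" for a b :: nat
    using that by presburger
  ultimately show False using block_rectangle(1,2)[OF tight K(1) t] * a by blast
qed

text \<open>The block has 36 - 12 = 24 zeros and each rectangle covers at most four.\<close>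

lemma six_block_count:
  assumes tight: "card T + card bips \<le> n" and K: "K \<in> bips" "card K = 6"
  shows "6 \<le> card T"
proof -
  have "(\<Sum>t\<in>T. card (I t \<inter> K) * card (J t \<inter> nbh K)) \<le> (\<Sum>t\<in>T. 4)"
    using six_block_rectangle[OF tight K] by (intro sum_mono) fastforce
  then show ?thesis using area_count[OF bipsD(1)[OF K(1)]] K(2) by simp
qed

text \<open>Six rectangles leave no slack: five cover at most 20 of the 24 zeros.\<close>

lemma six_block_all:
  assumes tight: "card T + card bips \<le> n" and K: "K \<in> bips" "card K = 6" and T: "card T = 6"
    and t: "t \<in> T"
  shows "card (I t \<inter> K) = 2" "card (J t \<inter> nbh K) = 2"
proof -
  have "card (I t \<inter> K) * card (J t \<inter> nbh K) \<noteq> 0"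
  proof
    assume "card (I t \<inter> K) * card (J t \<inter> nbh K) = 0"
    then have "(\<Sum>t\<in>T. card (I t \<inter> K) * card (J t \<inter> nbh K))
        = (\<Sum>t\<in>T - {t}. card (I t \<inter> K) * card (J t \<inter> nbh K))"
      using sum.remove[OF finite_T t, of "\<lambda>t. card (I t \<inter> K) * card (J t \<inter> nbh K)"] by simp
    also have "\<dots> \<le> (\<Sum>t\<in>T - {t}. 4)"
      using six_block_rectangle[OF tight K] by (intro sum_mono) fastforce
    also have "\<dots> = 20" using T t finite_T by simp
    finally show False using area_count[OF bipsD(1)[OF K(1)]] K(2) by simp
  qed
  then show "card (I t \<inter> K) = 2" "card (J t \<inter> nbh K) = 2"
    using six_block_rectangle[OF tight K t] by auto
qed

text \<open>In this case every rectangle meets the block in a \<open>2 \<times> 2\<close> square. The rectangles through the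
  outer row \<open>i\<^sub>0\<close> and those through the outer column \<open>j\<^sub>0\<close> form two triples, and every row
  and column of the block is determined by one rectangle from each triple; the twelve pairs
  obtained are distinct, but there are only nine.\<close>

lemma six_block_outer_row:
  assumes tight: "card T + card bips \<le> n" and K: "K \<in> bips" "card K = 6" and T: "card T = 6"
    and n: "6 < n"
  shows False
proof -
  note Kc = bipsD(1)[OF K(1)]
  note two = six_block_all[OF tight K T]
  have "\<not> {..<n} \<subseteq> K" using card_mono[OF finite_comp[OF Kc], of "{..<n}"] n K(2) by auto
  then obtain i0 where i0: "i0 < n" "i0 \<notin> K" by blast
  obtain j0 where j0: "j0 < n" "m i0 j0" using cols_nonempty[OF i0(1)] by (auto simp: cols_def)
  have outer: "\<not> m i j" if "i < n" "i \<notin> K" "j \<in> nbh K" for i j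
    using that comp_closed[OF Kc] by (auto simp: nbh_def cols_def)
  then have j0K: "j0 \<notin> nbh K" using i0 j0 by blast
  then have outer': "\<not> m i j0" if "i \<in> K" for i using that j0 by (auto simp: nbh_def cols_def)
  define T1 where "T1 = {t \<in> T. i0 \<in> I t}"
  define T2 where "T2 = {t \<in> T. j0 \<in> J t}"
  have fin: "finite T1" "finite T2" and sub: "T1 \<subseteq> T" "T2 \<subseteq> T"
    using finite_T by (auto simp: T1_def T2_def)
  \<comment> \<open>Row \<open>i0\<close> has zeros in all six block columns and each rectangle
    through it supplies two of them, so there are three such rectangles.\<close>
  have "cols i0 \<inter> nbh K = {}" using outer[OF i0] by (auto simp: cols_def)
  then have "(\<Sum>t\<in>T1. card (J t \<inter> nbh K)) = 6"
    using row_count[OF i0(1) nbh_subset, of K] card_nbh_comp[OF Kc] K(2) by (simp add: T1_def)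
  moreover have "(\<Sum>t\<in>T1. card (J t \<inter> nbh K)) = (\<Sum>t\<in>T1. 2)"
    using two sub by (intro sum.cong) auto
  ultimately have T1: "card T1 = 3" by simp
  have "rows j0 \<inter> K = {}" using outer' by (auto simp: rows_def)
  then have "(\<Sum>t\<in>T2. card (I t \<inter> K)) = 6"
    using col_count[OF j0(1) comp_subset[OF Kc]] K(2) by (simp add: T2_def)
  moreover have "(\<Sum>t\<in>T2. card (I t \<inter> K)) = (\<Sum>t\<in>T2. 2)"
    using two sub by (intro sum.cong) auto
  ultimately have T2: "card T2 = 3" by simp
  \<comment> \<open>The entry at \<open>i0\<close>, \<open>j0\<close> is a one, so no rectangle
    belongs to both triples.\<close>
  have "{t \<in> T. i0 \<in> I t \<and> j0 \<in> J t} = {}" using cell[OF i0(1) j0(1)] j0(2) finite_T by simp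
  then have disj: "T1 \<inter> T2 = {}" by (auto simp: T1_def T2_def)
  have T12: "T1 \<union> T2 = T"
    using card_Un_disjoint[OF fin disj] T T1 T2 sub by (intro card_subset_eq[OF finite_T]) auto
  define Q where "Q = (\<lambda>(a, b). {a, b}) ` (T1 \<times> T2)"
  have Q: "finite Q" "card Q \<le> 9"
    using fin T1 T2 card_image_le[of "T1 \<times> T2" "\<lambda>(a, b). {a, b}"]
    by (auto simp: Q_def card_cartesian_product)
  \<comment> \<open>The triples exhaust \<open>T\<close>, so a pair with exactly one member in one
    triple has its other member in the other.\<close>
  have in_Q: "F \<in> Q" if F: "F \<subseteq> T" "card F = 2" "card (F \<inter> T1) = 1 \<or> card (F \<inter> T2) = 1" for F
  proof -
    have "finite F" using F finite_T finite_subset by blast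
    then have "card (F \<inter> T1) + card (F \<inter> T2) = card ((F \<inter> T1) \<union> (F \<inter> T2))"
      using disj by (intro card_Un_disjoint[symmetric]) auto
    also have "(F \<inter> T1) \<union> (F \<inter> T2) = F" using F T12 by blast
    finally have "card (F \<inter> T1) = 1" "card (F \<inter> T2) = 1" using F by auto
    then obtain a b where ab: "F \<inter> T1 = {a}" "F \<inter> T2 = {b}" by (meson card_1_singletonE)
    then have "F = {a, b}" using F(1) T12 by blast
    then show ?thesis using ab unfolding Q_def by (intro image_eqI[of _ _ "(a, b)"]) auto
  qed
  define \<phi> where "\<phi> i = {t \<in> T. i \<in> I t}" for i
  define \<psi> where "\<psi> j = {t \<in> T. j \<in> J t}" for j
  have cell': "card (\<phi> i \<inter> \<psi> j) = (if m i j then 0 else 1)" if "i < n" "j < n" for i j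
  proof -
    have "\<phi> i \<inter> \<psi> j = {t \<in> T. i \<in> I t \<and> j \<in> J t}" by (auto simp: \<phi>_def \<psi>_def)
    then show ?thesis using cell[OF that] by simp
  qed
  \<comment> \<open>A row of the block has four zeros there, covered two at a time; likewise for
    columns.\<close>
  have card_\<phi>: "card (\<phi> i) = 2" if "i \<in> K" for i
  proof -
    have "(\<Sum>t\<in>\<phi> i. card (J t \<inter> nbh K)) = (\<Sum>t\<in>\<phi> i. 2)"
      using two by (intro sum.cong) (auto simp: \<phi>_def)
    then show ?thesis using row_count_comp[OF Kc that] K(2) by (simp add: \<phi>_def)
  qed
  have card_\<psi>: "card (\<psi> j) = 2" if "j \<in> nbh K" for j
  proof -
    have j: "j < n" using that nbh_subset by blast
    have "rows j \<inter> K = rows j" using that comp_closed[OF Kc] by (auto simp: nbh_def cols_def rows_def)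
    then have "(\<Sum>t\<in>\<psi> j. card (I t \<inter> K)) + 2 = 6"
      using col_count[OF j comp_subset[OF Kc]] card_rows[OF j] K(2) by (simp add: \<psi>_def)
    moreover have "(\<Sum>t\<in>\<psi> j. card (I t \<inter> K)) = (\<Sum>t\<in>\<psi> j. 2)"
      using two by (intro sum.cong) (auto simp: \<psi>_def)
    ultimately show ?thesis by simp
  qed
  have lt: "i < n" if "i \<in> K" for i using that comp_subset[OF Kc] by blast
  have lt': "j < n" if "j \<in> nbh K" for j using that nbh_subset by blast
  have "\<phi> ` K \<subseteq> Q"
  proof
    fix F assume "F \<in> \<phi> ` K"
    then obtain i where i: "i \<in> K" "F = \<phi> i" by blast
    have "F \<inter> T2 = \<phi> i \<inter> \<psi> j0" using i by (simp add: T2_def \<psi>_def)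
    then have "card (F \<inter> T2) = 1" using cell'[OF lt[OF i(1)] j0(1)] outer'[OF i(1)] by simp
    then show "F \<in> Q" using card_\<phi>[OF i(1)] i by (intro in_Q) (auto simp: \<phi>_def)
  qed
  moreover have "\<psi> ` nbh K \<subseteq> Q"
  proof
    fix F assume "F \<in> \<psi> ` nbh K"
    then obtain j where j: "j \<in> nbh K" "F = \<psi> j" by blast
    have "F \<inter> T1 = \<phi> i0 \<inter> \<psi> j" using j by (auto simp: T1_def \<phi>_def)
    then have "card (F \<inter> T1) = 1" using cell'[OF i0(1) lt'[OF j(1)]] outer[OF i0 j(1)] by simp
    then show "F \<in> Q" using card_\<psi>[OF j(1)] j by (intro in_Q) (auto simp: \<psi>_def)
  qed
  \<comment> \<open>If a row and a column had the same pair, the cell where they cross would lie in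
    two rectangles.\<close>
  moreover have "\<phi> ` K \<inter> \<psi> ` nbh K = {}"
  proof (rule ccontr)
    assume "\<phi> ` K \<inter> \<psi> ` nbh K \<noteq> {}"
    then obtain i j where ij: "i \<in> K" "j \<in> nbh K" "\<phi> i = \<psi> j" by blast
    then have "card (\<phi> i \<inter> \<psi> j) = 2" using card_\<psi> by simp
    then show False using cell'[OF lt[OF ij(1)] lt'[OF ij(2)]] by (simp split: if_splits)
  qed
  \<comment> \<open>By \<open>cell'\<close> the pair \<open>\<phi> i\<close> determines the whole
    row, so equal pairs would come from twin rows, which form a component of size two. The columns
    are treated in the same way.\<close>
  moreover have "inj_on \<phi> K"
  proof (rule inj_onI, rule ccontr)
    fix i i' assume i: "i \<in> K" "i' \<in> K" "\<phi> i = \<phi> i'" "i \<noteq> i'"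
    have "m i j = m i' j" if "j < n" for j
      using cell'[OF lt[OF i(1)] that] cell'[OF lt[OF i(2)] that] i(3) by (metis zero_neq_one)
    then have "cols i = cols i'" by (auto simp: cols_def)
    then have "K = {i, i'}" using twin_rows[OF Kc i(1) lt[OF i(2)]] i(4) by simp
    then show False using K(2) i(4) by simp
  qed
  moreover have "inj_on \<psi> (nbh K)"
  proof (rule inj_onI, rule ccontr)
    fix j j' assume j: "j \<in> nbh K" "j' \<in> nbh K" "\<psi> j = \<psi> j'" "j \<noteq> j'"
    have "m i j = m i j'" if "i < n" for i
      using cell'[OF that lt'[OF j(1)]] cell'[OF that lt'[OF j(2)]] j(3) by (metis zero_neq_one)
    then have "rows j = rows j'" by (auto simp: rows_def)
    then show False using twin_cols[OF Kc j(1) lt'[OF j(2)]] j(4) K(2) by simp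
  qed
  ultimately have "card (\<phi> ` K \<union> \<psi> ` nbh K) = 12" "\<phi> ` K \<union> \<psi> ` nbh K \<subseteq> Q"
    using card_Un_disjoint[of "\<phi> ` K" "\<psi> ` nbh K"] finite_comp[OF Kc] K(2) card_nbh_comp[OF Kc]
    by (simp_all add: card_image)
  then show False using card_mono[OF Q(1), of "\<phi> ` K \<union> \<psi> ` nbh K"] Q(2) by simp
qed

section \<open>Combining the bounds\<close>

lemma card_cover_bound:
  assumes four: "4 \<le> n - card {K \<in> bips. card K = 2}"
  shows "3 * (n - card {K \<in> bips. card K = 2}) + 4 \<le> 4 * card T"
proof (rule ccontr)
  define \<T> where "\<T> = {K \<in> bips. card K = 2}"
  define \<E> where "\<E> = {K \<in> bips. card K \<noteq> 2}"
  define \<rho> where "\<rho> = n - card \<T>"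
  assume "\<not> ?thesis"
  then have d: "4 * card T < 3 * \<rho> + 4" by (simp add: \<rho>_def \<T>_def)
  have four': "4 \<le> \<rho>" using four by (simp add: \<rho>_def \<T>_def)
  have fin: "finite \<T>" "finite \<E>" by (auto simp: \<T>_def \<E>_def)
  have split: "bips = \<T> \<union> \<E>" "\<T> \<inter> \<E> = {}" by (auto simp: \<T>_def \<E>_def)
  have bips: "card bips = card \<T> + card \<E>" using split fin card_Un_disjoint by metis
  have "(\<Sum>K\<in>bips. card K) = (\<Sum>K\<in>\<T>. card K) + (\<Sum>K\<in>\<E>. card K)"
    unfolding split(1) by (rule sum.union_disjoint[OF fin split(2)])
  also have "(\<Sum>K\<in>\<T>. card K) = 2 * card \<T>" by (simp add: \<T>_def)
  finally have "2 * card \<T> + (\<Sum>K\<in>\<E>. card K) \<le> n" using sum_card_bips by simp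
  then have sumE: "(\<Sum>K\<in>\<E>. card K) \<le> \<rho>" and n: "n = \<rho> + card \<T>" by (auto simp: \<rho>_def)
  have ge4: "4 \<le> card K" if "K \<in> \<E>" for K
  proof -
    have K: "K \<in> bips" "card K \<noteq> 2" using that by (auto simp: \<E>_def)
    have "card K \<noteq> 0" using comp_nonempty[OF bipsD(1)[OF K(1)]] finite_comp[OF bipsD(1)[OF K(1)]] by simp
    moreover have "4 \<le> k" if "even k" "k \<noteq> 0" "k \<noteq> 2" for k :: nat using that by presburger
    ultimately show ?thesis using K even_card_bip by blast
  qed
  have "card \<E> * 4 \<le> (\<Sum>K\<in>\<E>. card K)" using ge4 sum_bounded_below[of \<E> 4 card] by simp
  then have e4: "4 * card \<E> \<le> \<rho>" using sumE by simp
  have rank: "\<rho> \<le> card T + card \<E>" using rank_bound n bips by simp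
  \<comment> \<open>From \<open>4 * card T < 3 * \<rho> + 4\<close> and
    \<open>4 * card \<E> \<le> \<rho>\<close> follows
    \<open>card T + card \<E> < \<rho> + 1\<close>.\<close>
  have tight: "card T + card bips \<le> n" using d e4 n bips by simp
  have ge6: "6 \<le> card K" if "K \<in> \<E>" for K
  proof -
    have K: "K \<in> bips" using that by (auto simp: \<E>_def)
    have "6 \<le> k" if "even k" "4 \<le> k" "k \<noteq> 4" for k :: nat using that by presburger
    then show ?thesis using even_card_bip[OF K] ge4[OF that] no_four_block[OF tight K] by blast
  qed
  have "card \<E> * 6 \<le> (\<Sum>K\<in>\<E>. card K)" using ge6 sum_bounded_below[of \<E> 6 card] by simp
  then have "6 * card \<E> \<le> \<rho>" using sumE by simp
  \<comment> \<open>The rank bound gives \<open>\<rho> < 4 * card \<E> + 4\<close>. With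
    \<open>6 * card \<E> \<le> \<rho>\<close> this leaves at most one large component, and
    \<open>4 \<le> \<rho>\<close> excludes that there is none.\<close>
  then have e: "card \<E> = 1" using rank d four' by linarith
  then obtain K where K: "\<E> = {K}" by (meson card_1_singletonE)
  then have Kb: "K \<in> bips" by (auto simp: \<E>_def)
  have \<rho>7: "\<rho> \<le> 7" "\<rho> \<le> card T + 1" "card T < \<rho>" using rank d e tight bips n by linarith+
  have "card K \<le> 7" "6 \<le> card K" "even (card K)"
    using sumE K \<rho>7 ge6[of K] even_card_bip[OF Kb] by auto
  then have K6: "card K = 6" by (cases "card K = 7") auto
  \<comment> \<open>There are at least six rectangles but fewer than \<open>\<rho> \<le> 7\<close>;
    hence \<open>\<rho> = 7\<close> and some row lies outside the block.\<close>
  have "card T = 6" "6 < n" using six_block_count[OF tight Kb K6] \<rho>7 n by linarith+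
  then show False using six_block_outer_row[OF tight Kb K6] by blast
qed

end

section \<open>Transfer to real 0,1 matrices\<close>

lemma binary_rank_le:
  "rectangle_partition A P \<Longrightarrow> finite P \<Longrightarrow> binary_rank A \<le> card P"
  unfolding binary_rank_def by (rule Least_le) blast

theorem theorem1p7:
  fixes r :: nat and M :: "real mat"
  assumes "r \<ge> 4" and "two_regular_mat M" and "binary_rank M = r"
  shows "int (binary_rank (complement_mat M)) \<ge> \<lceil>3 * real r / 4\<rceil> + 1"
proof -
  define n where "n = dim_row M"
  define m where "m i j \<longleftrightarrow> M $$ (i, j) = 1" for i j
  have dim: "dim_row M = n" "dim_col M = n"
    using assms(2) by (auto simp: n_def two_regular_mat_def)
  have zero_one: "M $$ (i, j) = 0 \<or> M $$ (i, j) = 1" if "i < n" "j < n" for i j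
  proof -
    have "M $$ (i, j) \<in> elements_mat M" using that dim by (intro elements_matI) auto
    then show ?thesis using assms(2) by (auto simp: two_regular_mat_def zero_one_mat_def)
  qed
  interpret two_regular n m
    using assms(2) by unfold_locales (auto simp: two_regular_mat_def dim m_def)
  define b where "b = card {K \<in> bips. card K = 2}"
  \<comment> \<open>All rows with the same column set are merged into one rectangle, so the
    partition has at most as many members as there are distinct rows.\<close>
  define \<R> where "\<R> C = {i. i < n \<and> cols i = C} \<times> C" for C
  have ones: "mat_ones M = {(i, j). i < n \<and> j < n \<and> m i j}"
    by (simp add: mat_ones_def dim m_def)
  have "rectangle_partition M (\<R> ` cols ` {..<n})"
    unfolding rectangle_partition_def
  proof (intro conjI ballI partition_onI)
    show "\<Union>(\<R> ` cols ` {..<n}) = mat_ones M" by (auto simp: ones \<R>_def cols_def)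
  next
    fix p assume "p \<in> \<R> ` cols ` {..<n}"
    then obtain i where i: "i < n" "p = \<R> (cols i)" by blast
    have "p \<subseteq> mat_ones M" by (auto simp: i(2) ones \<R>_def cols_def)
    then show "all_one_rectangle M p" unfolding all_one_rectangle_def i(2) \<R>_def by blast
  next
    show "{} \<notin> \<R> ` cols ` {..<n}" using cols_nonempty by (auto simp: \<R>_def)
  next
    fix p q assume "p \<in> \<R> ` cols ` {..<n}" "q \<in> \<R> ` cols ` {..<n}" "p \<noteq> q"
    then show "disjnt p q" by (auto simp: \<R>_def disjnt_def)
  qed
  then have "r \<le> card (\<R> ` cols ` {..<n})" using binary_rank_le assms(3) by blast
  also have "\<dots> \<le> card (cols ` {..<n})" by (intro card_image_le) auto
  also have "\<dots> \<le> n - b" unfolding b_def by (rule card_distinct_rows)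
  finally have r: "r \<le> n - b" .

  let ?N = "complement_mat M"
  obtain P where P: "rectangle_partition ?N P" "finite P" "card P = binary_rank ?N"
    using binary_rank_attained by blast
  have ones': "mat_ones ?N = {(i, j). i < n \<and> j < n \<and> \<not> m i j}"
    by (auto simp: mat_ones_def complement_mat_def dim m_def) (use zero_one in blast)
  have part: "partition_on (mat_ones ?N) P" using P(1) by (simp add: rectangle_partition_def)
  \<comment> \<open>A rectangle is recovered from its projections, which thus serve as
    \<open>I\<close> and \<open>J\<close>.\<close>
  have rect: "t = fst ` t \<times> snd ` t" if t: "t \<in> P" for t
  proof -
    obtain A B where "t = A \<times> B"
      using P(1) t unfolding rectangle_partition_def all_one_rectangle_def by blast
    moreover have "t \<noteq> {}" using t partition_onD3[OF part] by blast
    ultimately show ?thesis by auto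
  qed
  have sub: "t \<subseteq> mat_ones ?N" if "t \<in> P" for t using part that by (auto simp: partition_on_def)
  interpret complement_cover n m P "\<lambda>t. fst ` t" "\<lambda>t. snd ` t"
  proof unfold_locales
    show "finite P" by (rule P(2))
    show "3 \<le> n" using r assms(1) by simp
    fix t assume t: "t \<in> P"
    show "fst ` t \<subseteq> {..<n}" "snd ` t \<subseteq> {..<n}" using sub[OF t] by (auto simp: ones')
  next
    fix i j assume ij: "i < n" "j < n"
    have eq: "{t \<in> P. i \<in> fst ` t \<and> j \<in> snd ` t} = {t \<in> P. (i, j) \<in> t}" using rect by blast
    show "card {t \<in> P. i \<in> fst ` t \<and> j \<in> snd ` t} = (if m i j then 0 else 1)"
    proof (cases "m i j")
      case True
      then have "{t \<in> P. (i, j) \<in> t} = {}" using sub by (auto simp: ones')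
      then show ?thesis using True unfolding eq by (metis card.empty)
    next
      case False
      then have "(i, j) \<in> \<Union>P" using partition_onD1[OF part] ij by (auto simp: ones')
      then obtain t where t: "t \<in> P" "(i, j) \<in> t" by blast
      then have "{t \<in> P. (i, j) \<in> t} = {t}" using disjointD[OF partition_onD2[OF part]] by blast
      then show ?thesis using False unfolding eq by (metis One_nat_def card_1_singleton_iff)
    qed
  qed
  have "3 * (n - b) + 4 \<le> 4 * card P"
    using card_cover_bound r assms(1) by (simp add: b_def)
  then have "3 * r + 4 \<le> 4 * binary_rank ?N" using r P(3) by simp
  \<comment> \<open>The summand 4 in \<open>card_cover_bound\<close> becomes the additional 1 after
    division by 4; since the rank is an integer, the ceiling comes for free.\<close>
  then have "3 * real r / 4 \<le> real_of_int (int (binary_rank ?N) - 1)" by simp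
  then have "\<lceil>3 * real r / 4\<rceil> \<le> int (binary_rank ?N) - 1" by (rule ceiling_le)
  then show ?thesis by simp
qed

end
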